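(* For every field $\mathbf{k}$ and every graph $G$, $$\mathrm{clique}(G)\leq s_{\mathbf{k}}\chi(G)\leq \chi(G).$$
   Context: Graphs are simple and undirected (no loops, no multiple edges). $\mathrm{clique}(G)$ is the number of vertices of a largest complete subgraph of $G$, and $\chi(G)$ is the usual chromatic number. For a field $\mathbf{k}$ and $n\ge 0$, let $P\mathbf{k}^n$ be the set of $1$-dimensional subspaces of $\mathbf{k}^n$ and $\mathrm{Gr}_{n-1}(\mathbf{k}^n)$ the set of $(n-1)$-dimensional subspaces. An $n$-span colouring of $G$ over $\mathbf{k}$ is a function assigning to each vertex $x$ a pair $(U_x,V_x)\in P\mathbf{k}^n\times \mathrm{Gr}_{n-1}(\mathbf{k}^n)$ such that $U_x\not\subset V_x$ for every vertex $x$, and $U_x\subset V_y$ and $U_y\subset V_x$ for every edge $(x,y)$. The span chromatic number $s_{\mathbf{k}}\chi(G)$ is the least $n$ such that $G$ has an $n$-span colouring over $\mathbf{k}$. Each of the three invariants is taken to be $\infty$ if no finite value exists. *)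

theory Defs
  imports "HOL-Library.Extended_Nat" "HOL-Library.Function_Algebras"
begin

section \<open>Graphs\<close>

definition simple_graph :: "'v set \<Rightarrow> 'v set set \<Rightarrow> bool" where
  "simple_graph V E \<longleftrightarrow> (\<forall>e\<in>E. e \<subseteq> V \<and> card e = 2)"

definition is_clique :: "'v set \<Rightarrow> 'v set set \<Rightarrow> 'v set \<Rightarrow> bool" where
  "is_clique V E K \<longleftrightarrow> K \<subseteq> V \<and> (\<forall>x\<in>K. \<forall>y\<in>K. x \<noteq> y \<longrightarrow> {x, y} \<in> E)"

text \<open>The vertex set may be infinite. An infinite clique contains finite cliques of every
  size, so ranging over finite cliques yields \<open>\<infinity>\<close> exactly when there is no largest
  finite value.\<close>

definition clique_number :: "'v set \<Rightarrow> 'v set set \<Rightarrow> enat" where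
  "clique_number V E = Sup {enat (card K) | K. finite K \<and> is_clique V E K}"

definition proper_colouring :: "'v set \<Rightarrow> 'v set set \<Rightarrow> nat \<Rightarrow> ('v \<Rightarrow> nat) \<Rightarrow> bool" where
  "proper_colouring V E n c \<longleftrightarrow>
     (\<forall>x\<in>V. c x < n) \<and> (\<forall>x y. {x, y} \<in> E \<longrightarrow> c x \<noteq> c y)"

text \<open>In \<^typ>\<open>enat\<close> the infimum of a nonempty set is its least element and the infimum
  of the empty set is \<open>\<infinity>\<close>.\<close>

definition chromatic_number :: "'v set \<Rightarrow> 'v set set \<Rightarrow> enat" where
  "chromatic_number V E = Inf {enat n | n. \<exists>c. proper_colouring V E n c}"

section \<open>Coordinate spaces\<close>

text \<open>As \<open>n\<close> has to vary inside the formulas, all the spaces \<open>k\<^sup>n\<close> are realised inside the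
  vector space of sequences over \<open>k\<close>.\<close>

definition seq_scale :: "'k::field \<Rightarrow> (nat \<Rightarrow> 'k) \<Rightarrow> nat \<Rightarrow> 'k" where
  "seq_scale a v = (\<lambda>i. a * v i)"

global_interpretation seq: vector_space "seq_scale :: 'k::field \<Rightarrow> (nat \<Rightarrow> 'k) \<Rightarrow> nat \<Rightarrow> 'k"
  by unfold_locales (auto simp: seq_scale_def algebra_simps)

definition coord_space :: "nat \<Rightarrow> (nat \<Rightarrow> 'k::field) set" where
  "coord_space n = {v. \<forall>i\<ge>n. v i = 0}"

definition proj_space :: "nat \<Rightarrow> (nat \<Rightarrow> 'k::field) set set" where
  "proj_space n = {S. seq.subspace S \<and> S \<subseteq> coord_space n \<and> seq.dim S = 1}"

text \<open>Writing \<open>dim S + 1 = n\<close> avoids truncated subtraction: there are no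
  \<open>(-1)\<close>-dimensional subspaces of \<open>k\<^sup>0\<close>.\<close>

definition hyperplanes :: "nat \<Rightarrow> (nat \<Rightarrow> 'k::field) set set" where
  "hyperplanes n = {S. seq.subspace S \<and> S \<subseteq> coord_space n \<and> seq.dim S + 1 = n}"

section \<open>Span colourings\<close>

definition span_colouring ::
  "'v set \<Rightarrow> 'v set set \<Rightarrow> nat \<Rightarrow> ('v \<Rightarrow> (nat \<Rightarrow> 'k::field) set \<times> (nat \<Rightarrow> 'k) set) \<Rightarrow> bool" where
  "span_colouring V E n f \<longleftrightarrow>
     (\<forall>x\<in>V. f x \<in> proj_space n \<times> hyperplanes n) \<and>
     (\<forall>x\<in>V. \<not> fst (f x) \<subseteq> snd (f x)) \<and>
     (\<forall>x y. {x, y} \<in> E \<longrightarrow> fst (f x) \<subseteq> snd (f y) \<and> fst (f y) \<subseteq> snd (f x))"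

definition span_chromatic_number :: "'k::field itself \<Rightarrow> 'v set \<Rightarrow> 'v set set \<Rightarrow> enat" where
  "span_chromatic_number k V E =
     Inf {enat n | n. \<exists>f :: 'v \<Rightarrow> (nat \<Rightarrow> 'k) set \<times> (nat \<Rightarrow> 'k) set. span_colouring V E n f}"

end

theory Submission
  imports Defs
begin

text \<open>If \<open>f\<close> is an \<open>n\<close>-span colouring and \<open>K\<close> a finite clique, choose
  \<open>u\<^sub>x \<in> U\<^sub>x - V\<^sub>x\<close> for each \<open>x \<in> K\<close>. Then \<open>V\<^sub>x\<close> contains every \<open>u\<^sub>y\<close> with
  \<open>y \<noteq> x\<close> but not \<open>u\<^sub>x\<close>, so the \<open>u\<^sub>x\<close> are linearly independent in \<open>k\<^sup>n\<close>. Conversely, a proper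
  colouring \<open>c\<close> with \<open>n\<close> colours yields the \<open>n\<close>-span colouring taking \<open>x\<close> to the line through
  the basis vector \<open>e\<^bsub>c x\<^esub>\<close> and the hyperplane spanned by the other basis vectors.\<close>

text \<open>The span of the remaining vectors stays inside \<open>W x\<close>, which misses
  \<open>u x\<close>. This serves both the vectors chosen from a clique and, with coordinate
  hyperplanes as \<open>W\<close>, the unit sequences.\<close>

lemma (in vector_space) separated_family_inj_independent:
  assumes sub: "\<And>x. x \<in> I \<Longrightarrow> subspace (W x)"
    and out: "\<And>x. x \<in> I \<Longrightarrow> u x \<notin> W x"
    and into: "\<And>x y. x \<in> I \<Longrightarrow> y \<in> I \<Longrightarrow> x \<noteq> y \<Longrightarrow> u y \<in> W x"
  shows "inj_on u I" and "independent (u ` I)"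
proof -
  show inj: "inj_on u I"
    using out into by (metis inj_onI)
  show "independent (u ` I)"
    unfolding dependent_def
  proof safe
    fix x assume x: "x \<in> I" and span: "u x \<in> span (u ` I - {u x})"
    have "span (u ` I - {u x}) \<subseteq> W x"
      using into x by (intro span_minimal sub) auto
    with span out x show False by blast
  qed
qed

definition unit_seq :: "nat \<Rightarrow> nat \<Rightarrow> 'k::field" where
  "unit_seq i = (\<lambda>j. if j = i then 1 else 0)"

lemma subspace_coord_space: "seq.subspace (coord_space n)"
  by (auto simp: seq.subspace_def coord_space_def seq_scale_def)

lemma unit_seq_in_coord_space: "i < n \<Longrightarrow> unit_seq i \<in> coord_space n"
  by (auto simp: coord_space_def unit_seq_def)

lemma subspace_coordinate_zero: "seq.subspace {v. v i = 0}"
  by (auto simp: seq.subspace_def seq_scale_def)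

lemma inj_on_unit_seq: "inj_on (unit_seq :: nat \<Rightarrow> nat \<Rightarrow> 'k::field) I"
  by (rule seq.separated_family_inj_independent(1)[where W = "\<lambda>i. {v. v i = 0}"])
    (auto simp: unit_seq_def subspace_coordinate_zero)

lemma independent_unit_seq: "seq.independent ((unit_seq :: nat \<Rightarrow> nat \<Rightarrow> 'k::field) ` I)"
  by (rule seq.separated_family_inj_independent(2)[where W = "\<lambda>i. {v. v i = 0}"])
    (auto simp: unit_seq_def subspace_coordinate_zero)

lemma dim_span_unit_seq:
  "seq.dim (seq.span ((unit_seq :: nat \<Rightarrow> nat \<Rightarrow> 'k::field) ` I)) = card I"
  by (metis card_image independent_unit_seq inj_on_unit_seq seq.dim_eq_card_independent seq.dim_span)

lemma span_unit_seq_subset_coord_space: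
  "I \<subseteq> {..<n} \<Longrightarrow> seq.span (unit_seq ` I) \<subseteq> coord_space n"
  by (intro seq.span_minimal subspace_coord_space) (auto intro!: unit_seq_in_coord_space)

lemma coord_space_subset_span: "coord_space n \<subseteq> seq.span (unit_seq ` {..<n})"
proof
  fix v :: "nat \<Rightarrow> 'k::field" assume v: "v \<in> coord_space n"
  have sum_apply: "(\<Sum>i\<in>I. w i) j = (\<Sum>i\<in>I. w i j)" if "finite I"
    for I :: "nat set" and w :: "nat \<Rightarrow> nat \<Rightarrow> 'k" and j
    using that by induction auto
  have "v = (\<Sum>i<n. seq_scale (v i) (unit_seq i))"
  proof
    fix j
    have "(\<Sum>i<n. seq_scale (v i) (unit_seq i) j) = (\<Sum>i<n. if j = i then v i else 0)"
      by (intro sum.cong) (auto simp: seq_scale_def unit_seq_def)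
    \<comment> \<open>For \<open>j < n\<close> only the term \<open>i = j\<close> survives; for
      \<open>j \<ge> n\<close> no term does, and \<open>v j = 0\<close> since \<open>v\<close> lies
      in \<open>coord_space n\<close>.\<close>
    also have "\<dots> = v j"
      using v by (auto simp: coord_space_def)
    finally show "v j = (\<Sum>i<n. seq_scale (v i) (unit_seq i)) j"
      by (simp add: sum_apply)
  qed
  also have "\<dots> \<in> seq.span (unit_seq ` {..<n})"
    by (intro seq.span_sum seq.span_scale seq.span_base) auto
  finally show "v \<in> seq.span (unit_seq ` {..<n})" .
qed

text \<open>Steinitz exchange against the \<open>n\<close> unit sequences, which span. It also makes
  \<open>B\<close> finite, so the bound on \<open>card B\<close> is not an artefact of infinite sets
  having \<open>card\<close> 0.\<close>

lemma card_le_if_independent_coord_space: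
  assumes "seq.independent B" and "B \<subseteq> coord_space n"
  shows "card B \<le> n"
proof -
  have "card B \<le> card ((unit_seq :: nat \<Rightarrow> nat \<Rightarrow> 'a) ` {..<n})"
    using assms coord_space_subset_span by (intro seq.independent_span_bound[THEN conjunct2]) auto
  then show ?thesis
    by (simp add: card_image inj_on_unit_seq)
qed

lemma card_clique_le_span_colouring:
  assumes f: "span_colouring V E n f" and K: "is_clique V E K"
  shows "card K \<le> n"
proof -
  have KV: "K \<subseteq> V" and edge: "\<And>x y. x \<in> K \<Longrightarrow> y \<in> K \<Longrightarrow> x \<noteq> y \<Longrightarrow> {x, y} \<in> E"
    using K by (auto simp: is_clique_def)
  have "\<exists>v. v \<in> fst (f x) \<and> v \<notin> snd (f x)" if "x \<in> K" for x
    using f KV that unfolding span_colouring_def by blast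
  then obtain u where u: "\<And>x. x \<in> K \<Longrightarrow> u x \<in> fst (f x)" "\<And>x. x \<in> K \<Longrightarrow> u x \<notin> snd (f x)"
    by metis
  have spaces: "fst (f x) \<subseteq> coord_space n" "seq.subspace (snd (f x))" if "x \<in> K" for x
  proof -
    have "f x \<in> proj_space n \<times> hyperplanes n"
      using f KV that unfolding span_colouring_def by blast
    then show "fst (f x) \<subseteq> coord_space n" "seq.subspace (snd (f x))"
      by (auto simp: proj_space_def hyperplanes_def)
  qed
  have into: "u y \<in> snd (f x)" if "x \<in> K" "y \<in> K" "x \<noteq> y" for x y
    using f u(1) edge[OF that] that unfolding span_colouring_def by blast
  note fam = seq.separated_family_inj_independent[where W = "\<lambda>x. snd (f x)", OF spaces(2) u(2) into]
  have "card (u ` K) \<le> n"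
    using fam(2) u(1) spaces(1) by (intro card_le_if_independent_coord_space) auto
  then show ?thesis
    using fam(1) by (simp add: card_image)
qed

lemma span_colouring_if_proper_colouring:
  assumes c: "proper_colouring V E n c" and G: "simple_graph V E"
  shows "span_colouring V E n (\<lambda>x. (seq.span {unit_seq (c x) :: nat \<Rightarrow> 'k::field},
    seq.span (unit_seq ` ({..<n} - {c x}))))"
    (is "span_colouring V E n (\<lambda>x. (?U x, ?V x))")
proof -
  have less: "c x < n" if "x \<in> V" for x
    using c that by (simp add: proper_colouring_def)
  have line: "?U x \<in> proj_space n" if "x \<in> V" for x
    using dim_span_unit_seq[of "{c x}"] span_unit_seq_subset_coord_space[of "{c x}" n] less[OF that]
    by (simp add: proj_space_def)
  \<comment> \<open>Since \<open>c x < n\<close>, exactly one of the \<open>n\<close> basis vectors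
    is removed. Dropping \<open>seq.dim_span\<close> from the simpset keeps the span in the form
    that \<open>dim_span_unit_seq\<close> rewrites.\<close>
  have hyper: "?V x \<in> hyperplanes n" if "x \<in> V" for x
    using less[OF that]
    by (simp add: hyperplanes_def dim_span_unit_seq span_unit_seq_subset_coord_space del: seq.dim_span)
  have notin: "unit_seq (c x) \<notin> ?V x" for x
  proof -
    \<comment> \<open>All generators of \<open>?V x\<close> vanish at coordinate \<open>c x\<close>,
      hence so does their span.\<close>
    have "?V x \<subseteq> {v. v (c x) = 0}"
      by (intro seq.span_minimal subspace_coordinate_zero) (auto simp: unit_seq_def)
    moreover have "unit_seq (c x) (c x) \<noteq> (0 :: 'k)"
      by (simp add: unit_seq_def)
    ultimately show ?thesis by blast
  qed
  have transversal: "\<not> ?U x \<subseteq> ?V x" for x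
    using notin seq.span_base[of "unit_seq (c x)" "{unit_seq (c x)}"] by blast
  have incident: "?U x \<subseteq> ?V y" if "{x, y} \<in> E" for x y
  proof -
    \<comment> \<open>Together with \<open>c x < n\<close>, which follows from
      \<open>x \<in> V\<close>, this puts the generator of \<open>?U x\<close> among those of
      \<open>?V y\<close>.\<close>
    have "x \<in> V" "c x \<noteq> c y"
      using c G that by (auto simp: proper_colouring_def simple_graph_def)
    then show ?thesis
      using less by (intro seq.span_mono) auto
  qed
  show ?thesis
    unfolding span_colouring_def fst_conv snd_conv mem_Times_iff
  proof (intro conjI ballI allI impI)
    fix x y assume "{x, y} \<in> E"
    then show "?U x \<subseteq> ?V y" and "?U y \<subseteq> ?V x"
      using incident[of x y] incident[of y x] by (simp_all only: insert_commute)
  qed (use line hyper transversal in blast)+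
qed

theorem proposition1p2:
  fixes V :: "'v set" and E :: "'v set set"
  assumes "simple_graph V E"
  shows "clique_number V E \<le> span_chromatic_number TYPE('k::field) V E
    \<and> span_chromatic_number TYPE('k) V E \<le> chromatic_number V E"
proof
  show "clique_number V E \<le> span_chromatic_number TYPE('k) V E"
    unfolding clique_number_def span_chromatic_number_def
    \<comment> \<open>Comparing each finite clique with each admissible \<open>n\<close> also covers
      infinite values.\<close>
    by (intro Sup_least Inf_greatest) (auto dest: card_clique_le_span_colouring)
  show "span_chromatic_number TYPE('k) V E \<le> chromatic_number V E"
    unfolding span_chromatic_number_def chromatic_number_def
    using span_colouring_if_proper_colouring[OF _ assms] by (intro Inf_superset_mono) blast
qed

end
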